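(* For every integer $k \geq 3$, $$AR_d(C_k) \leq \begin{cases} 2(k-1) & \text{if } k \text{ is even},\\ 2(k+2) & \text{if } k \text{ is odd.}\end{cases}$$
   Context: $C_k$ denotes the cycle on $k$ vertices. A proper edge colouring assigns colours to edges so that edges sharing a vertex receive distinct colours. A copy of $H$ in an edge-coloured graph is rainbow if all its edges have distinct colours. The degree anti-Ramsey number $AR_d(H)$ is the smallest integer $m$ for which there exists a (finite, simple) graph $G$ with maximum degree at most $m$ such that every proper edge colouring of $G$ contains a rainbow copy of $H$. *)

theory Defs
  imports Main "HOL-Library.Extended_Nat"
begin

type_synonym 'a ugraph = "'a set \<times> 'a set set"

abbreviation verts :: "'a ugraph \<Rightarrow> 'a set" where
  "verts G \<equiv> fst G"

abbreviation edges :: "'a ugraph \<Rightarrow> 'a set set" where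
  "edges G \<equiv> snd G"

definition finite_simple_graph :: "'a ugraph \<Rightarrow> bool" where
  "finite_simple_graph G \<longleftrightarrow>
     finite (verts G) \<and> (\<forall>e\<in>edges G. e \<subseteq> verts G \<and> card e = 2)"

definition vertex_degree :: "'a ugraph \<Rightarrow> 'a \<Rightarrow> nat" where
  "vertex_degree G v = card {e \<in> edges G. v \<in> e}"

text \<open>The graph without vertices has maximum degree 0.\<close>

definition max_degree :: "'a ugraph \<Rightarrow> nat" where
  "max_degree G = Max (insert 0 (vertex_degree G ` verts G))"

definition subgraph :: "'a ugraph \<Rightarrow> 'a ugraph \<Rightarrow> bool" where
  "subgraph K G \<longleftrightarrow>
     finite_simple_graph K \<and> verts K \<subseteq> verts G \<and> edges K \<subseteq> edges G"

definition isomorphic :: "'a ugraph \<Rightarrow> 'b ugraph \<Rightarrow> bool" where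
  "isomorphic H K \<longleftrightarrow>
     (\<exists>f. bij_betw f (verts H) (verts K) \<and> edges K = (\<lambda>e. f ` e) ` edges H)"

definition proper_edge_colouring :: "'a ugraph \<Rightarrow> ('a set \<Rightarrow> 'c) \<Rightarrow> bool" where
  "proper_edge_colouring G c \<longleftrightarrow>
     (\<forall>e\<in>edges G. \<forall>f\<in>edges G. e \<noteq> f \<and> e \<inter> f \<noteq> {} \<longrightarrow> c e \<noteq> c f)"

definition has_rainbow_copy :: "'b ugraph \<Rightarrow> 'a ugraph \<Rightarrow> ('a set \<Rightarrow> 'c) \<Rightarrow> bool" where
  "has_rainbow_copy H G c \<longleftrightarrow>
     (\<exists>K. subgraph K G \<and> isomorphic H K \<and> inj_on c (edges K))"

text \<open>
  Host graphs have vertices in \<^typ>\<open>nat\<close> and colours are in \<^typ>\<open>nat\<close>; up to renaming this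
  covers all finite graphs and all of their edge colourings. The infimum is taken in
  \<^typ>\<open>enat\<close>, so that the value is the minimum if some \<open>m\<close> is admissible and \<open>\<infinity>\<close> otherwise.
\<close>

definition degree_anti_ramsey :: "'b ugraph \<Rightarrow> enat" where
  "degree_anti_ramsey H =
     Inf {enat m | m. \<exists>G :: nat ugraph. finite_simple_graph G \<and> max_degree G \<le> m \<and>
            (\<forall>c :: nat set \<Rightarrow> nat. proper_edge_colouring G c \<longrightarrow> has_rainbow_copy H G c)}"

definition cycle_graph :: "nat \<Rightarrow> nat ugraph" where
  "cycle_graph k = ({..<k}, {{i, (i + 1) mod k} | i. i < k})"

lemma degree_anti_ramsey_le_iff:
  "degree_anti_ramsey H \<le> enat m \<longleftrightarrow>
     (\<exists>G :: nat ugraph. finite_simple_graph G \<and> max_degree G \<le> m \<and>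
        (\<forall>c :: nat set \<Rightarrow> nat. proper_edge_colouring G c \<longrightarrow> has_rainbow_copy H G c))"
  (is "_ \<longleftrightarrow> ?P m")
proof
  let ?S = "{enat n | n. ?P n}"
  assume le: "degree_anti_ramsey H \<le> enat m"
  have "?S \<noteq> {}"
  proof
    assume "?S = {}"
    then have "degree_anti_ramsey H = \<infinity>"
      unfolding degree_anti_ramsey_def Inf_enat_def by (rule if_P)
    with le show False
      by simp
  qed
  then have "Inf ?S \<in> ?S"
    by (metis (mono_tags, lifting) Inf_enat_def LeastI ex_in_conv)
  then obtain n where "Inf ?S = enat n" and n: "?P n"
    by blast
  with le have "n \<le> m"
    by (simp add: degree_anti_ramsey_def)
  with n show "?P m"
    using le_trans by blast
next
  assume "?P m"
  then show "degree_anti_ramsey H \<le> enat m"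
    unfolding degree_anti_ramsey_def by (intro Inf_lower) blast
qed

lemma finite_simple_cycle_graph:
  assumes "k \<ge> 3"
  shows "finite_simple_graph (cycle_graph k)"
proof -
  have "(i + 1) mod k \<noteq> i" if "i < k" for i
    using that assms by (cases "i + 1 = k") auto
  then show ?thesis
    using assms by (auto simp: finite_simple_graph_def cycle_graph_def card_2_iff)
qed

end

theory Submission
  imports Defs
begin

text \<open>
  The host graph is a blow-up of \<open>C\<^sub>k\<close> with layers of three sizes: hubs (one vertex), middle layers
  (\<open>k - 1\<close> vertices) and closing layers (\<open>2 k - 3\<close> vertices), arranged cyclically in the pattern
  hub, middle, closing, middle, with up to two extra hubs next to position \<open>0\<close> when \<open>k\<close> is not
  divisible by 4. A layer at distance two from a closing layer is always a hub, so all degrees are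
  at most \<open>2 (k - 1)\<close>. Given a proper colouring, a rainbow transversal cycle is built greedily:
  first the hubs, then the middle layers, then the closing layers. When a vertex is chosen, at most
  \<open>k - 2\<close> colours are in use, and by properness each of them excludes at most one candidate for
  each neighbour that is already chosen. A middle vertex sees one such neighbour and a closing
  vertex sees two, so some candidate always survives. This gives \<open>2 (k - 1)\<close> for odd \<open>k\<close> as well.
\<close>

section \<open>Cyclic positions and blow-ups of a cycle\<close>

definition next_pos :: "nat \<Rightarrow> nat \<Rightarrow> nat" where
  "next_pos k i = (if Suc i = k then 0 else Suc i)"

definition prev_pos :: "nat \<Rightarrow> nat \<Rightarrow> nat" where
  "prev_pos k i = (if i = 0 then k - 1 else i - 1)"

lemma next_pos_less: "i < k \<Longrightarrow> next_pos k i < k"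
  by (auto simp: next_pos_def)

lemma prev_pos_less: "i < k \<Longrightarrow> prev_pos k i < k"
  by (auto simp: prev_pos_def)

lemma prev_next_pos: "i < k \<Longrightarrow> prev_pos k (next_pos k i) = i"
  by (auto simp: next_pos_def prev_pos_def)

lemma next_pos_eq_mod: "i < k \<Longrightarrow> (i + 1) mod k = next_pos k i"
  by (auto simp: next_pos_def)

lemma next_pos_neq: "k \<ge> 2 \<Longrightarrow> next_pos k i \<noteq> i"
  by (auto simp: next_pos_def)

text \<open>The natural number \<open>v\<close> encodes vertex number \<open>v div k\<close> of layer \<open>v mod k\<close>.\<close>

definition layer :: "nat \<Rightarrow> (nat \<Rightarrow> nat) \<Rightarrow> nat \<Rightarrow> nat set" where
  "layer k d i = {v. v mod k = i \<and> v div k < d i}"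

definition cycle_blowup :: "nat \<Rightarrow> (nat \<Rightarrow> nat) \<Rightarrow> nat ugraph" where
  "cycle_blowup k d =
     (\<Union>i<k. layer k d i,
      {{u, v} | u v i. i < k \<and> u \<in> layer k d i \<and> v \<in> layer k d (next_pos k i)})"

lemma cycle_blowup_edgeI:
  "i < k \<Longrightarrow> u \<in> layer k d i \<Longrightarrow> v \<in> layer k d (next_pos k i) \<Longrightarrow>
     {u, v} \<in> edges (cycle_blowup k d)"
  unfolding cycle_blowup_def snd_conv by blast

lemma cycle_blowup_edgeE:
  assumes "e \<in> edges (cycle_blowup k d)"
  obtains u v i where "e = {u, v}" "i < k" "u \<in> layer k d i" "v \<in> layer k d (next_pos k i)"
  using assms unfolding cycle_blowup_def snd_conv by blast

lemma layer_eq_image: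
  assumes "i < k"
  shows "layer k d i = (\<lambda>a. a * k + i) ` {..<d i}"
proof (intro set_eqI iffI)
  fix v assume "v \<in> layer k d i"
  then have "v = (v div k) * k + i" "v div k < d i"
    by (auto simp: layer_def)
  then show "v \<in> (\<lambda>a. a * k + i) ` {..<d i}"
    by blast
next
  fix v assume "v \<in> (\<lambda>a. a * k + i) ` {..<d i}"
  then show "v \<in> layer k d i"
    using assms by (auto simp: layer_def)
qed

lemma finite_layer: "i < k \<Longrightarrow> finite (layer k d i)"
  by (simp add: layer_eq_image)

lemma card_layer:
  assumes "i < k"
  shows "card (layer k d i) = d i"
proof -
  have "inj_on (\<lambda>a. a * k + i) {..<d i}"
    using assms by (auto simp: inj_on_def)
  then show ?thesis
    using assms by (simp add: layer_eq_image card_image)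
qed

lemma layer_position: "v \<in> layer k d i \<Longrightarrow> v mod k = i"
  by (simp add: layer_def)

lemma finite_simple_cycle_blowup:
  assumes "k \<ge> 2"
  shows "finite_simple_graph (cycle_blowup k d)"
proof -
  have neq: "u \<noteq> v" if "u \<in> layer k d i" "v \<in> layer k d (next_pos k i)" for u v i
    using that next_pos_neq[OF assms, of i] by (auto simp: layer_def)
  have "e \<subseteq> verts (cycle_blowup k d) \<and> card e = 2" if e_in: "e \<in> edges (cycle_blowup k d)" for e
  proof -
    obtain u v i where e: "e = {u, v}" "i < k"
      and uv: "u \<in> layer k d i" "v \<in> layer k d (next_pos k i)"
      using e_in by (rule cycle_blowup_edgeE)
    then have "e \<subseteq> verts (cycle_blowup k d)"
      using next_pos_less[OF e(2)] by (auto simp: cycle_blowup_def)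
    with neq[OF uv] e show ?thesis
      by simp
  qed
  then show ?thesis
    by (simp add: finite_simple_graph_def) (simp add: cycle_blowup_def finite_layer)
qed

text \<open>Since \<open>v mod k\<close> recovers the layer of \<open>v\<close>, every neighbour of
  \<open>v\<close> lies in one of the two adjacent layers.\<close>

lemma max_degree_cycle_blowup:
  assumes d: "\<And>i. i < k \<Longrightarrow> d (next_pos k i) + d (prev_pos k i) \<le> m"
  shows "max_degree (cycle_blowup k d) \<le> m"
proof -
  have "vertex_degree (cycle_blowup k d) v \<le> m" if v: "v \<in> layer k d i" "i < k" for v i
  proof -
    let ?N = "layer k d (next_pos k i) \<union> layer k d (prev_pos k i)"
    have fin: "finite ?N"
      using v by (simp add: finite_layer next_pos_less prev_pos_less)
    have "{e \<in> edges (cycle_blowup k d). v \<in> e} \<subseteq> (\<lambda>u. {v, u}) ` ?N"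
    proof
      fix e assume "e \<in> {e \<in> edges (cycle_blowup k d). v \<in> e}"
      then have "v \<in> e" "e \<in> edges (cycle_blowup k d)"
        by auto
      from this(2) obtain u w j where e: "e = {u, w}" "j < k"
        and uw: "u \<in> layer k d j" "w \<in> layer k d (next_pos k j)"
        by (rule cycle_blowup_edgeE)
      with \<open>v \<in> e\<close> have "v = u \<or> v = w"
        by simp
      then show "e \<in> (\<lambda>u. {v, u}) ` ?N"
      proof
        assume "v = u"
        then show ?thesis
          using e uw layer_position[OF v(1)] layer_position[OF uw(1)] by auto
      next
        assume "v = w"
        then have "prev_pos k i = j"
          using layer_position[OF v(1)] layer_position[OF uw(2)] prev_next_pos[OF e(2)] by simp
        then show ?thesis
          using \<open>v = w\<close> e uw by blast
      qed
    qed
    then have "vertex_degree (cycle_blowup k d) v \<le> card ((\<lambda>u. {v, u}) ` ?N)"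
      unfolding vertex_degree_def using fin by (intro card_mono) auto
    also have "\<dots> \<le> card ?N"
      using fin by (rule card_image_le)
    also have "\<dots> \<le> d (next_pos k i) + d (prev_pos k i)"
      using card_Un_le[of "layer k d (next_pos k i)" "layer k d (prev_pos k i)"] v
      by (simp add: card_layer next_pos_less prev_pos_less)
    also have "\<dots> \<le> m"
      using d v by blast
    finally show ?thesis .
  qed
  then show ?thesis
    by (auto simp: max_degree_def cycle_blowup_def finite_layer)
qed

section \<open>Partial rainbow transversals and their greedy extension\<close>

text \<open>In the injectivity condition, position \<open>i\<close> stands for the edge from layer \<open>i\<close> to the next.\<close>

definition rainbow_partial ::
  "nat \<Rightarrow> (nat \<Rightarrow> nat) \<Rightarrow> (nat set \<Rightarrow> 'c) \<Rightarrow> nat set \<Rightarrow> (nat \<Rightarrow> nat) \<Rightarrow> bool" where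
  "rainbow_partial k d c S x \<longleftrightarrow>
     S \<subseteq> {..<k} \<and> (\<forall>i\<in>S. x i \<in> layer k d i) \<and>
     inj_on (\<lambda>i. c {x i, x (next_pos k i)}) {i \<in> S. next_pos k i \<in> S}"

lemma rainbow_partial_imp_rainbow_cycle:
  assumes x: "rainbow_partial k d c {..<k} x" and k: "k \<ge> 3"
  shows "has_rainbow_copy (cycle_graph k) (cycle_blowup k d) c"
proof -
  let ?E = "(\<lambda>i. {x i, x (next_pos k i)}) ` {..<k}"
  let ?K = "(x ` {..<k}, ?E)"
  have lay: "x i \<in> layer k d i" if "i < k" for i
    using x that by (simp add: rainbow_partial_def)
  \<comment> \<open>Layers are disjoint: the residue mod \<open>k\<close> of a vertex gives its
    position. So \<open>x\<close> itself will serve as the isomorphism.\<close>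
  have inj: "inj_on x {..<k}"
    by (metis inj_onI lay layer_position lessThan_iff)
  have "{i \<in> {..<k}. next_pos k i \<in> {..<k}} = {..<k}"
    by (auto simp: next_pos_less)
  then have "inj_on (c \<circ> (\<lambda>i. {x i, x (next_pos k i)})) {..<k}"
    using x by (simp add: rainbow_partial_def comp_def)
  then have rainbow: "inj_on c ?E"
    by (rule inj_on_imageI)
  have "x i \<noteq> x (next_pos k i)" if "i < k" for i
    using that inj next_pos_neq[of k i] next_pos_less[of i k] k by (auto simp: inj_on_eq_iff)
  then have "finite_simple_graph ?K"
    by (auto simp: finite_simple_graph_def card_2_iff next_pos_less)
  moreover have "x ` {..<k} \<subseteq> verts (cycle_blowup k d)"
    using lay by (auto simp: cycle_blowup_def)
  moreover have "?E \<subseteq> edges (cycle_blowup k d)"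
  proof
    fix e assume "e \<in> ?E"
    then obtain i where "i < k" "e = {x i, x (next_pos k i)}"
      by blast
    then show "e \<in> edges (cycle_blowup k d)"
      using lay next_pos_less by (auto intro: cycle_blowup_edgeI)
  qed
  ultimately have "subgraph ?K (cycle_blowup k d)"
    by (simp add: subgraph_def)
  moreover have "edges (cycle_graph k) = (\<lambda>i. {i, (i + 1) mod k}) ` {..<k}"
    unfolding cycle_graph_def by auto
  then have "edges (cycle_graph k) = (\<lambda>i. {i, next_pos k i}) ` {..<k}"
    using next_pos_eq_mod by (metis (no_types, lifting) image_cong lessThan_iff)
  then have "isomorphic (cycle_graph k) ?K"
    unfolding isomorphic_def
    by (intro exI[of _ x]) (use inj in \<open>auto simp: cycle_graph_def bij_betw_def image_image\<close>)
  ultimately show ?thesis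
    unfolding has_rainbow_copy_def using rainbow by (intro exI[of _ ?K]) auto
qed

text \<open>All these edges meet in \<open>w\<close>, so properness makes \<open>y\<close>
  determined by the colour of \<open>{y, w}\<close>.\<close>

lemma card_candidates_with_colour_in:
  assumes c: "proper_edge_colouring G c" and fin: "finite U"
    and Y: "\<And>y. y \<in> Y \<Longrightarrow> {y, w} \<in> edges G"
  shows "card {y \<in> Y. c {y, w} \<in> U} \<le> card U"
proof (rule card_inj_on_le[of "\<lambda>y. c {y, w}"])
  have "c {y, w} \<noteq> c {z, w}" if "y \<in> Y" "z \<in> Y" "y \<noteq> z" for y z
  proof -
    have "{y, w} \<noteq> {z, w}" "{y, w} \<inter> {z, w} \<noteq> {}"
      using that by (auto simp: doubleton_eq_iff)
    then show ?thesis
      using c Y[OF that(1)] Y[OF that(2)] by (simp add: proper_edge_colouring_def)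
  qed
  then show "inj_on (\<lambda>y. c {y, w}) {y \<in> Y. c {y, w} \<in> U}"
    by (intro inj_onI) blast
qed (use fin in auto)

lemma rainbow_partial_insert:
  assumes c: "proper_edge_colouring (cycle_blowup k d) c" and k: "k \<ge> 3"
    and x: "rainbow_partial k d c S x" and i: "i < k" "i \<notin> S"
    and d: "(if next_pos k i \<in> S then k - 2 else 0) + (if prev_pos k i \<in> S then k - 2 else 0) < d i"
  shows "\<exists>y. rainbow_partial k d c (insert i S) (x(i := y))"
proof -
  let ?n = "next_pos k i" and ?p = "prev_pos k i"
  let ?I = "{j \<in> S. next_pos k j \<in> S}"
  let ?col = "\<lambda>j. c {x j, x (next_pos k j)}"
  define U where "U = ?col ` ?I"
  have S: "S \<subseteq> {..<k}" and lay: "\<And>j. j \<in> S \<Longrightarrow> x j \<in> layer k d j" and inj: "inj_on ?col ?I"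
    using x by (auto simp: rainbow_partial_def)
  have pn: "?p < k" "?n < k" "next_pos k ?p = i" "?n \<noteq> ?p" "?n \<noteq> i" "?p \<noteq> i"
    using i k by (auto simp: next_pos_def prev_pos_def)
  \<comment> \<open>The positions \<open>i\<close> and \<open>?p\<close> stand for the two edges at
    layer \<open>i\<close>; neither is present while \<open>i\<close> is not in \<open>S\<close>.
    This is the source of \<open>k - 2\<close>.\<close>
  have I: "?I \<subseteq> {..<k} - {i, ?p}"
    using S i pn by auto
  have "card ({..<k} - {i, ?p}) = k - 2"
    using i pn by (subst card_Diff_subset) auto
  then have "card ?I \<le> k - 2"
    using card_mono[OF _ I] by simp
  moreover have "finite ?I"
    using I finite_subset by blast
  ultimately have U: "card U \<le> k - 2" "finite U"
    using card_image_le[of ?I ?col] by (auto simp: U_def)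
  have edge: "{y, x j} \<in> edges (cycle_blowup k d)"
    if "j \<in> S" "y \<in> layer k d i" "j = ?n \<or> j = ?p" for y j
    using that(3)
  proof
    assume "j = ?n"
    then show ?thesis
      using that lay[of j] i by (auto intro: cycle_blowup_edgeI)
  next
    assume "j = ?p"
    then have "x j \<in> layer k d ?p" "y \<in> layer k d (next_pos k ?p)" "{y, x j} = {x j, y}"
      using that lay[of j] pn by auto
    then show ?thesis
      using pn(1) cycle_blowup_edgeI by metis
  qed
  \<comment> \<open>\<open>B j\<close> collects the candidates whose edge to \<open>x j\<close>
    would repeat a used colour; it is empty if no vertex has been chosen in layer
    \<open>j\<close>.\<close>
  define B where "B j = {y \<in> layer k d i. j \<in> S \<and> c {y, x j} \<in> U}" for j
  have B: "card (B j) \<le> (if j \<in> S then k - 2 else 0)" if "j = ?n \<or> j = ?p" for j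
  proof (cases "j \<in> S")
    case True
    have "card {y \<in> layer k d i. c {y, x j} \<in> U} \<le> card U"
      using edge True that by (intro card_candidates_with_colour_in[OF c U(2)]) blast
    with U(1) True show ?thesis
      by (simp add: B_def)
  qed (simp add: B_def)
  have "card (B ?n \<union> B ?p) < card (layer k d i)"
    using card_Un_le[of "B ?n" "B ?p"] B[of ?n] B[of ?p] d i
    by (auto simp: card_layer split: if_splits)
  moreover have "finite (B ?n \<union> B ?p)"
    using finite_layer i by (auto simp: B_def)
  ultimately obtain y where y: "y \<in> layer k d i" "y \<notin> B ?n" "y \<notin> B ?p"
    by (metis UnCI card_mono leD subsetI)
  define x' where "x' = x(i := y)"
  let ?col' = "\<lambda>j. c {x' j, x' (next_pos k j)}"
  let ?I' = "{j \<in> insert i S. next_pos k j \<in> insert i S}"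
  have old: "?col' j = ?col j" if "j \<in> ?I" for j
    using that i by (auto simp: x'_def)
  have col_i: "?col' i = c {y, x ?n}"
    using pn by (simp add: x'_def)
  have col_p: "?col' ?p = c {y, x ?p}"
    using pn by (simp add: x'_def insert_commute)
  have new_i: "?col' i \<notin> U" if "?n \<in> S"
    using that y by (simp add: col_i B_def)
  have new_p: "?col' ?p \<notin> U" if "?p \<in> S"
    using that y by (simp add: col_p B_def)
  \<comment> \<open>Avoiding \<open>U\<close> does not separate the two new edges from each other,
    but they share \<open>y\<close>, so properness does.\<close>
  have new_ip: "?col' i \<noteq> ?col' ?p" if "?n \<in> S" "?p \<in> S"
  proof -
    have "x ?n \<noteq> x ?p"
      using lay that pn layer_position by metis
    then have "{y, x ?n} \<noteq> {y, x ?p}"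
      by (auto simp: doubleton_eq_iff)
    then show ?thesis
      using c edge[OF that(1) y(1)] edge[OF that(2) y(1)] unfolding col_i col_p
      by (auto simp: proper_edge_colouring_def)
  qed
  have cases: "j \<in> ?I \<or> (j = i \<and> ?n \<in> S) \<or> (j = ?p \<and> ?p \<in> S)" if "j \<in> ?I'" for j
    using that S i pn prev_next_pos[of j k] by auto
  have col_U: "?col' j \<in> U" if "j \<in> ?I" for j
    using that by (simp only: old) (auto simp: U_def)
  have "inj_on ?col' ?I'"
  proof (rule inj_onI)
    fix j l assume jl: "j \<in> ?I'" "l \<in> ?I'" and eq: "?col' j = ?col' l"
    consider "j \<in> ?I" "l \<in> ?I" | "j \<in> ?I" "l \<notin> ?I" | "j \<notin> ?I" "l \<in> ?I" | "j \<notin> ?I" "l \<notin> ?I"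
      by blast
    then show "j = l"
    proof cases
      case 1
      then have "?col j = ?col l"
        using eq old[of j] old[of l] by simp
      then show ?thesis
        using inj_onD[OF inj] 1 by blast
    next
      case 2
      then show ?thesis
        using cases[OF jl(2)] col_U[of j] eq new_i new_p by auto
    next
      case 3
      then show ?thesis
        using cases[OF jl(1)] col_U[of l] eq new_i new_p by auto
    next
      case 4
      then show ?thesis
        using cases[OF jl(1)] cases[OF jl(2)] eq new_ip by auto
    qed
  qed
  moreover have "\<forall>j\<in>insert i S. x' j \<in> layer k d j"
    using lay y i by (auto simp: x'_def)
  ultimately have "rainbow_partial k d c (insert i S) x'"
    using S i by (simp add: rainbow_partial_def)
  then show ?thesis
    unfolding x'_def by blast
qed

text \<open>The layers of \<open>T\<close> may be filled in any order: a neighbour outside the final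
  set \<open>S \<union> T\<close> is also unchosen at every earlier stage.\<close>

lemma rainbow_partial_Un:
  assumes c: "proper_edge_colouring (cycle_blowup k d) c" and k: "k \<ge> 3"
    and x: "rainbow_partial k d c S x" and fin: "finite T"
    and T: "T \<subseteq> {..<k}" "T \<inter> S = {}"
    and d: "\<And>i. i \<in> T \<Longrightarrow> 2 * k - 3 \<le> d i \<or>
              k - 1 \<le> d i \<and> (next_pos k i \<notin> S \<union> T \<or> prev_pos k i \<notin> S \<union> T)"
  shows "\<exists>x'. rainbow_partial k d c (S \<union> T) x'"
  using fin T d
proof (induction T rule: finite_induct)
  case empty
  then show ?case
    using x by auto
next
  case (insert i T)
  have "\<exists>x'. rainbow_partial k d c (S \<union> T) x'"
    by (rule insert.IH) (use insert.prems in blast)+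
  then obtain x' where x': "rainbow_partial k d c (S \<union> T) x'"
    by blast
  have "2 * k - 3 \<le> d i \<or> k - 1 \<le> d i \<and> (next_pos k i \<notin> S \<union> T \<or> prev_pos k i \<notin> S \<union> T)"
    using insert.prems(3)[of i] by auto
  \<comment> \<open>The sizes are \<open>2 * (k - 2) + 1\<close> and \<open>(k - 2) + 1\<close>: one
    more than two neighbours, or one, can exclude.\<close>
  then have "(if next_pos k i \<in> S \<union> T then k - 2 else 0) +
      (if prev_pos k i \<in> S \<union> T then k - 2 else 0) < d i"
    using k by auto
  then have "\<exists>y. rainbow_partial k d c (insert i (S \<union> T)) (x'(i := y))"
    using insert.prems insert.hyps by (intro rainbow_partial_insert[OF c k x']) auto
  then show ?case
    by auto
qed

section \<open>Layer sizes and the hub pattern modulo 4\<close>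

text \<open>The exceptions repair the wrap-around. If \<open>k mod 4 = 2\<close>, position
  \<open>k - 1\<close> would be a middle layer with no closing neighbour. If
  \<open>k mod 4 = 3\<close>, position \<open>k - 1\<close> is closing and lies at distance two from
  position 1.\<close>

definition is_hub :: "nat \<Rightarrow> nat \<Rightarrow> bool" where
  "is_hub k i \<longleftrightarrow> i mod 4 = 0 \<or> (k mod 4 = 2 \<and> Suc i = k) \<or> (k mod 4 = 3 \<and> i = 1)"

definition layer_size :: "nat \<Rightarrow> nat \<Rightarrow> nat" where
  "layer_size k i = (if is_hub k i then 1 else if even i then 2 * k - 3 else k - 1)"

lemma even_iff_mod_4: "even n \<longleftrightarrow> n mod 4 = 0 \<or> n mod 4 = 2" for n :: nat
  by presburger

lemma mod_4_cases: "n mod 4 = 0 \<or> n mod 4 = 1 \<or> n mod 4 = 2 \<or> n mod 4 = 3" for n :: nat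
  by presburger

text \<open>Both kinds of extra hub sit at odd positions, so the even positions keep their
  pattern.\<close>

lemma closing_iff:
  assumes "k \<ge> 3" "i < k"
  shows "even i \<and> \<not> is_hub k i \<longleftrightarrow> i mod 4 = 2"
  using assms mod_4_cases[of i] by (auto simp: is_hub_def even_iff_mod_4 mod_Suc)

text \<open>No wrap-around can occur here, as position 0 is not closing; two steps back from residue
  2 is residue 0.\<close>

lemma hub_before_closing:
  assumes "k \<ge> 3" "i < k" "next_pos k i mod 4 = 2"
  shows "is_hub k (prev_pos k i)"
proof (cases i)
  case 0
  then show ?thesis
    using assms by (auto simp: next_pos_def split: if_splits)
next
  case (Suc j)
  then show ?thesis
    using assms mod_4_cases[of j]
    by (auto simp: next_pos_def prev_pos_def is_hub_def mod_Suc split: if_splits)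
qed

text \<open>For \<open>i = 0\<close> the closing layer is \<open>k - 1\<close>, and the extra hub at
  position 1 is what is required. Otherwise the next position has residue 0, possibly after wrapping
  to 0.\<close>

lemma hub_after_closing:
  assumes "k \<ge> 3" "i < k" "prev_pos k i mod 4 = 2"
  shows "is_hub k (next_pos k i)"
proof (cases i)
  case 0
  obtain m where "k = Suc m"
    using assms by (cases k) auto
  then show ?thesis
    using 0 assms by (auto simp: next_pos_def prev_pos_def is_hub_def mod_Suc split: if_splits)
next
  case (Suc j)
  then show ?thesis
    using assms by (auto simp: next_pos_def prev_pos_def is_hub_def mod_Suc split: if_splits)
qed

text \<open>A closing neighbour is paired with a hub, giving \<open>(2 * k - 3) + 1\<close>; without
  one, both sizes are at most \<open>k - 1\<close>.\<close>

lemma layer_size_neighbours: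
  assumes "k \<ge> 3" "i < k"
  shows "layer_size k (next_pos k i) + layer_size k (prev_pos k i) \<le> 2 * (k - 1)"
  using assms hub_before_closing[OF assms] hub_after_closing[OF assms]
    closing_iff[of k "next_pos k i"] closing_iff[of k "prev_pos k i"]
  by (auto simp: layer_size_def next_pos_less prev_pos_less)

text \<open>Residue 1 is followed and residue 3 preceded by residue 2. Only \<open>k - 1\<close> for
  \<open>k mod 4 = 2\<close> would fail, and it is a hub.\<close>

lemma middle_next_to_closing:
  assumes "k \<ge> 3" "i < k" "odd i" "\<not> is_hub k i"
  shows "next_pos k i mod 4 = 2 \<or> prev_pos k i mod 4 = 2"
proof -
  obtain j where "i = Suc j"
    using assms(3) by (cases i) auto
  then show ?thesis
    using assms mod_4_cases[of j]
    by (auto simp: next_pos_def prev_pos_def is_hub_def mod_Suc even_iff_mod_4 split: if_splits)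
qed

lemma hub_edge_positions:
  assumes "k \<ge> 3" "i < k" "is_hub k i" "is_hub k (next_pos k i)"
  shows "k mod 4 = 1 \<and> Suc i = k \<or> k mod 4 = 2 \<and> (Suc i = k \<or> Suc (Suc i) = k) \<or>
         k mod 4 = 3 \<and> i = 0"
  using assms mod_4_cases[of i]
  by (auto simp: next_pos_def is_hub_def mod_Suc split: if_splits)

text \<open>Hub layers leave no choice of vertex, so properness alone must make the hub edges
  rainbow. It does: there are two such edges only for \<open>k mod 4 = 2\<close>, and they meet at
  \<open>k - 1\<close>.\<close>

lemma hub_edges_consecutive:
  assumes "k \<ge> 3" "i < k" "j < k" "i \<noteq> j"
    and "is_hub k i" "is_hub k (next_pos k i)" "is_hub k j" "is_hub k (next_pos k j)"
  shows "j = next_pos k i \<or> i = next_pos k j"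
  using hub_edge_positions[of k i] hub_edge_positions[of k j] assms by (auto simp: next_pos_def)

section \<open>Rainbow cycles in proper colourings of the host graph\<close>

lemma rainbow_partial_hubs:
  assumes c: "proper_edge_colouring (cycle_blowup k (layer_size k)) c" and k: "k \<ge> 3"
  shows "rainbow_partial k (layer_size k) c {i. i < k \<and> is_hub k i} (\<lambda>i. i)"
proof -
  let ?H = "{i. i < k \<and> is_hub k i}"
  \<comment> \<open>The only vertex of hub layer \<open>i\<close> has number 0 and is encoded by
    \<open>i\<close> itself, hence the identity as the choice function.\<close>
  have lay: "i \<in> layer k (layer_size k) i" if "i \<in> ?H" for i
    using that by (simp add: layer_def layer_size_def)
  have edge: "{i, next_pos k i} \<in> edges (cycle_blowup k (layer_size k))"
    if "i \<in> ?H" "next_pos k i \<in> ?H" for i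
    using that lay by (auto intro: cycle_blowup_edgeI)
  have adjacent: "c {i, next_pos k i} \<noteq> c {next_pos k i, next_pos k (next_pos k i)}"
    if "i \<in> ?H" "next_pos k i \<in> ?H" "next_pos k (next_pos k i) \<in> ?H" for i
  proof -
    have "next_pos k (next_pos k i) \<noteq> i"
      using k by (auto simp: next_pos_def)
    then have "{i, next_pos k i} \<noteq> {next_pos k i, next_pos k (next_pos k i)}"
      by (auto simp: doubleton_eq_iff)
    then show ?thesis
      using c edge[OF that(1,2)] edge[OF that(2,3)] by (auto simp: proper_edge_colouring_def)
  qed
  have "inj_on (\<lambda>i. c {i, next_pos k i}) {i \<in> ?H. next_pos k i \<in> ?H}"
  proof (rule inj_onI, rule ccontr)
    fix i j assume ij: "i \<in> {i \<in> ?H. next_pos k i \<in> ?H}" "j \<in> {i \<in> ?H. next_pos k i \<in> ?H}"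
      and eq: "c {i, next_pos k i} = c {j, next_pos k j}" and "i \<noteq> j"
    then have "j = next_pos k i \<or> i = next_pos k j"
      using hub_edges_consecutive[OF k, of i j] by auto
    then show False
      using adjacent[of i] adjacent[of j] ij eq by auto
  qed
  then show ?thesis
    using lay by (auto simp: rainbow_partial_def)
qed

lemma rainbow_cycle_in_blowup:
  assumes c: "proper_edge_colouring (cycle_blowup k (layer_size k)) c" and k: "k \<ge> 3"
  shows "has_rainbow_copy (cycle_graph k) (cycle_blowup k (layer_size k)) c"
proof -
  let ?d = "layer_size k"
  let ?H = "{i. i < k \<and> is_hub k i}"
  let ?M = "{i. i < k \<and> odd i \<and> \<not> is_hub k i}"
  let ?C = "{i. i < k \<and> even i \<and> \<not> is_hub k i}"
  have "\<exists>x. rainbow_partial k ?d c (?H \<union> ?M) x"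
  proof (rule rainbow_partial_Un[OF c k rainbow_partial_hubs[OF c k]])
    \<comment> \<open>The closing neighbour of a middle layer is in neither \<open>?H\<close> nor
      \<open>?M\<close>, so it is still unchosen.\<close>
    fix i assume "i \<in> ?M"
    then show "2 * k - 3 \<le> ?d i \<or>
        k - 1 \<le> ?d i \<and> (next_pos k i \<notin> ?H \<union> ?M \<or> prev_pos k i \<notin> ?H \<union> ?M)"
      using middle_next_to_closing[OF k, of i] closing_iff[OF k, of "next_pos k i"]
        closing_iff[OF k, of "prev_pos k i"]
      by (auto simp: layer_size_def next_pos_less prev_pos_less)
  qed auto
  then obtain x where x: "rainbow_partial k ?d c (?H \<union> ?M) x"
    by blast
  have "\<exists>x. rainbow_partial k ?d c ((?H \<union> ?M) \<union> ?C) x"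
    by (rule rainbow_partial_Un[OF c k x]) (auto simp: layer_size_def)
  moreover have "(?H \<union> ?M) \<union> ?C = {..<k}"
    by auto
  ultimately show ?thesis
    using rainbow_partial_imp_rainbow_cycle k by metis
qed

theorem theorem1p4:
  fixes k :: nat
  assumes "k \<ge> 3"
  shows "degree_anti_ramsey (cycle_graph k) \<le>
           enat (if even k then 2 * (k - 1) else 2 * (k + 2))"
proof -
  have "max_degree (cycle_blowup k (layer_size k)) \<le> 2 * (k - 1)"
    using max_degree_cycle_blowup layer_size_neighbours assms by blast
  moreover have "finite_simple_graph (cycle_blowup k (layer_size k))"
    using finite_simple_cycle_blowup assms by simp
  ultimately have "degree_anti_ramsey (cycle_graph k) \<le> enat (2 * (k - 1))"
    unfolding degree_anti_ramsey_le_iff using rainbow_cycle_in_blowup assms by blast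
  \<comment> \<open>For odd \<open>k\<close> the bound just obtained is stronger than the one
    claimed.\<close>
  also have "\<dots> \<le> enat (if even k then 2 * (k - 1) else 2 * (k + 2))"
    by auto
  finally show ?thesis .
qed

end
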